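(* Let $\mathcal Q$ be the set of graphs on $n$ vertices containing no induced subgraph with $4$ vertices and $3$ edges. Then $$\left\lfloor\frac{n^2-5n}{4}\right\rfloor\le\mathrm{Dist}(n,\mathcal Q)\le\frac{n^2-n}{4}.$$
   Context: An edge-operation is the deletion of an existing edge or the addition of a non-existing edge. For an $n$-vertex graph $G$ and a family $\mathcal H$ of $n$-vertex graphs, $\mathrm{Dist}(G,\mathcal H)$ is the minimum of $|E(G)\,\Delta\,E(G')|$ over graphs $G'$ on vertex set $V(G)$ isomorphic to a member of $\mathcal H$, and $\mathrm{Dist}(n,\mathcal H)=\max\{\mathrm{Dist}(G,\mathcal H):|V(G)|=n\}$. *)

theory Defs
  imports Complex_Main
begin

type_synonym 'a graph = "'a set \<times> 'a set set"

abbreviation verts :: "'a graph \<Rightarrow> 'a set" where "verts G \<equiv> fst G"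

abbreviation edges :: "'a graph \<Rightarrow> 'a set set" where "edges G \<equiv> snd G"

definition simple_graph :: "'a graph \<Rightarrow> bool" where
  "simple_graph G \<longleftrightarrow> finite (verts G) \<and> (\<forall>e\<in>edges G. e \<subseteq> verts G \<and> card e = 2)"

definition isomorphic :: "'a graph \<Rightarrow> 'b graph \<Rightarrow> bool" where
  "isomorphic G H \<longleftrightarrow> (\<exists>f. bij_betw f (verts G) (verts H) \<and>
     (\<forall>u\<in>verts G. \<forall>v\<in>verts G. {u, v} \<in> edges G \<longleftrightarrow> {f u, f v} \<in> edges H))"

definition induced_subgraph :: "'a graph \<Rightarrow> 'a graph \<Rightarrow> bool" where
  "induced_subgraph H G \<longleftrightarrow> verts H \<subseteq> verts G \<and> edges H = {e \<in> edges G. e \<subseteq> verts H}"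

text \<open>The minimum is over a finite set of naturals (bounded by the number of vertex pairs), which
  is nonempty if and only if the family contains a graph with as many vertices as \<open>G\<close>.\<close>
definition edit_dist :: "'a graph \<Rightarrow> 'b graph set \<Rightarrow> nat" where
  "edit_dist G \<H> = Min {card ((edges G - edges G') \<union> (edges G' - edges G)) | G'.
     simple_graph G' \<and> verts G' = verts G \<and> (\<exists>H\<in>\<H>. isomorphic G' H)}"

text \<open>Every finite graph is isomorphic to one whose vertices are natural numbers, and
  \<open>edit_dist\<close> is invariant under isomorphism, so restricting to vertices of type
  \<^typ>\<open>nat\<close> loses nothing.\<close>
definition max_edit_dist :: "nat \<Rightarrow> 'b graph set \<Rightarrow> nat" where
  "max_edit_dist n \<H> = Max {edit_dist G \<H> | G :: nat graph. simple_graph G \<and> card (verts G) = n}"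

definition no_induced_4_3 :: "nat \<Rightarrow> nat graph set" where
  "no_induced_4_3 n = {G. simple_graph G \<and> card (verts G) = n \<and>
     \<not> (\<exists>H. induced_subgraph H G \<and> card (verts H) = 4 \<and> card (edges H) = 3)}"

end

theory Submission
  imports Defs "HOL-Library.Ramsey"
begin

text \<open>
  Call a graph good if no four of its vertices span exactly three edges. The complement of a good
  graph is good, since three is half of the six pairs. A good graph cannot contain both a triangle
  and an independent triple: a triangle vertex adjacent to the whole triple would form a claw with
  it, but any two nonadjacent vertices outside a triangle have two common neighbours in it. In a
  good triangle-free graph all degrees are at most two, again because there is no claw, so there
  are at most \<open>n\<close> edges. Hence every good graph has at most \<open>n\<close> edges or at most \<open>n\<close> non-edges, and
  a graph with half of all the pairs as edges is far from all of them. For the upper bound, the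
  empty graph and the complete graph are good.
\<close>

section \<open>Induced edges and neighbours\<close>

definition induced_edges :: "'a graph \<Rightarrow> 'a set \<Rightarrow> 'a set set" where
  "induced_edges G W = {e \<in> edges G. e \<subseteq> W}"

definition neighbours :: "'a graph \<Rightarrow> 'a set \<Rightarrow> 'a \<Rightarrow> 'a set" where
  "neighbours G W v = {w \<in> W. {v, w} \<in> edges G}"

lemma simple_graph_iff_nsets:
  "simple_graph G \<longleftrightarrow> finite (verts G) \<and> edges G \<subseteq> [verts G]\<^bsup>2\<^esup>"
  by (auto simp: simple_graph_def nsets_def intro: card_ge_0_finite)

lemma simple_graph_finite_edges: "simple_graph G \<Longrightarrow> finite (edges G)"
  by (meson finite_imp_finite_nsets finite_subset simple_graph_iff_nsets)

lemma simple_graph_irrefl: "simple_graph G \<Longrightarrow> {v, v} \<notin> edges G"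
  by (auto simp: simple_graph_def)

lemma simple_graph_edgeE:
  assumes "simple_graph G" "e \<in> edges G"
  obtains x y where "e = {x, y}" "x \<in> verts G" "y \<in> verts G" "x \<noteq> y"
  using assms unfolding simple_graph_iff_nsets by (meson nsets2_E subsetD)

lemma card_induced_edges_insert:
  assumes "simple_graph G" "finite W" "v \<notin> W"
  shows "card (induced_edges G (insert v W)) = card (induced_edges G W) + card (neighbours G W v)"
proof -
  have "induced_edges G (insert v W) = induced_edges G W \<union> (\<lambda>w. {v, w}) ` neighbours G W v"
  proof (intro equalityI subsetI)
    fix e assume e: "e \<in> induced_edges G (insert v W)"
    then have "e \<in> edges G" by (simp add: induced_edges_def)
    then obtain x y where "e = {x, y}" "x \<noteq> y"
      by (rule simple_graph_edgeE[OF assms(1)])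
    with e show "e \<in> induced_edges G W \<union> (\<lambda>w. {v, w}) ` neighbours G W v"
      by (auto simp: induced_edges_def neighbours_def insert_commute)
  qed (auto simp: induced_edges_def neighbours_def)
  moreover have "induced_edges G W \<inter> (\<lambda>w. {v, w}) ` neighbours G W v = {}"
    using assms(3) by (auto simp: induced_edges_def)
  moreover have "finite (induced_edges G W)"
    using simple_graph_finite_edges[OF assms(1)] by (simp add: induced_edges_def)
  moreover have "finite (neighbours G W v)" "inj_on (\<lambda>w. {v, w}) (neighbours G W v)"
    using assms(2) by (auto simp: neighbours_def inj_on_def doubleton_eq_iff)
  ultimately show ?thesis
    by (simp add: card_Un_disjoint card_image)
qed

lemma induced_edges_clique:
  assumes "simple_graph G" "finite K" "clique K (edges G)"
  shows "induced_edges G K = [K]\<^bsup>2\<^esup>"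
proof
  show "induced_edges G K \<subseteq> [K]\<^bsup>2\<^esup>"
    using assms(1,2) by (auto simp: induced_edges_def simple_graph_def nsets_def finite_subset)
  show "[K]\<^bsup>2\<^esup> \<subseteq> induced_edges G K"
    using assms(3) by (auto simp: induced_edges_def clique_def elim!: nsets2_E)
qed

lemma induced_edges_indep:
  assumes "simple_graph G" "indep I (edges G)"
  shows "induced_edges G I = {}"
proof -
  have "\<not> e \<subseteq> I" if e: "e \<in> edges G" for e
  proof -
    obtain x y where "e = {x, y}" "x \<noteq> y"
      using assms(1) e by (rule simple_graph_edgeE)
    then show ?thesis using e assms(2) by (auto simp: indep_def)
  qed
  then show ?thesis by (auto simp: induced_edges_def)
qed

lemma sum_card_neighbours:
  assumes "simple_graph G"
  shows "(\<Sum>v\<in>verts G. card (neighbours G (verts G) v)) = 2 * card (edges G)"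
proof -
  have "card (neighbours G (verts G) v) = card {e \<in> edges G. v \<in> e}" for v
  proof (rule bij_betw_same_card)
    show "bij_betw (\<lambda>w. {v, w}) (neighbours G (verts G) v) {e \<in> edges G. v \<in> e}"
      unfolding bij_betw_def
    proof (intro conjI equalityI subsetI)
      show "inj_on (\<lambda>w. {v, w}) (neighbours G (verts G) v)"
        by (auto simp: inj_on_def doubleton_eq_iff)
      fix e assume e: "e \<in> {e \<in> edges G. v \<in> e}"
      then obtain x y where "e = {x, y}" "x \<in> verts G" "y \<in> verts G"
        using simple_graph_edgeE[OF assms] by blast
      with e show "e \<in> (\<lambda>w. {v, w}) ` neighbours G (verts G) v"
        by (auto simp: neighbours_def insert_commute)
    qed (auto simp: neighbours_def)
  qed
  moreover have "card {v \<in> verts G. v \<in> e} = 2" if "e \<in> edges G" for e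
  proof -
    have "{v \<in> verts G. v \<in> e} = e" "card e = 2"
      using assms that by (auto simp: simple_graph_def)
    then show ?thesis by simp
  qed
  ultimately show ?thesis
    using sum_multicount[of "verts G" "edges G" "\<lambda>v e. v \<in> e" 2] assms
      simple_graph_finite_edges[OF assms] by (simp add: simple_graph_def)
qed

section \<open>Graphs without induced subgraphs of a given order and size\<close>

definition no_induced :: "nat \<Rightarrow> nat \<Rightarrow> 'a graph \<Rightarrow> bool" where
  "no_induced k m G \<longleftrightarrow>
     simple_graph G \<and> (\<forall>W\<in>[verts G]\<^bsup>k\<^esup>. card (induced_edges G W) \<noteq> m)"

definition complement :: "'a graph \<Rightarrow> 'a graph" where
  "complement G = (verts G, [verts G]\<^bsup>2\<^esup> - edges G)"

definition triangles :: "'a graph \<Rightarrow> 'a set set" where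
  "triangles G = {K \<in> [verts G]\<^bsup>3\<^esup>. clique K (edges G)}"

lemma no_induced_simple_graph: "no_induced k m G \<Longrightarrow> simple_graph G"
  by (simp add: no_induced_def)

lemma mem_no_induced_4_3_iff:
  "G \<in> no_induced_4_3 n \<longleftrightarrow> no_induced 4 3 G \<and> card (verts G) = n"
proof -
  have "(\<exists>H. induced_subgraph H G \<and> card (verts H) = 4 \<and> card (edges H) = 3) \<longleftrightarrow>
      (\<exists>W\<in>[verts G]\<^bsup>4\<^esup>. card (induced_edges G W) = 3)" (is "?L \<longleftrightarrow> ?R")
  proof
    assume ?L
    then obtain H where H: "induced_subgraph H G" "card (verts H) = 4" "card (edges H) = 3"
      by blast
    then have "verts H \<in> [verts G]\<^bsup>4\<^esup>" "card (induced_edges G (verts H)) = 3"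
      by (simp_all add: induced_subgraph_def induced_edges_def nsets_def card_ge_0_finite)
    then show ?R ..
  next
    assume ?R
    then obtain W where W: "W \<in> [verts G]\<^bsup>4\<^esup>" "card (induced_edges G W) = 3"
      by blast
    then have "induced_subgraph (W, induced_edges G W) G"
      by (simp add: induced_subgraph_def induced_edges_def nsets_def)
    with W show ?L
      by (intro exI[of _ "(W, induced_edges G W)"]) (simp add: nsets_def)
  qed
  then show ?thesis
    by (simp add: no_induced_4_3_def no_induced_def) blast
qed

lemma no_induced_empty: "finite V \<Longrightarrow> 0 < m \<Longrightarrow> no_induced k m (V, {})"
  by (simp add: no_induced_def simple_graph_def induced_edges_def)

lemma card_edges_complement:
  assumes "simple_graph G"
  shows "card (edges G) + card (edges (complement G)) = card (verts G) choose 2"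
proof -
  have "edges G \<subseteq> [verts G]\<^bsup>2\<^esup>" "finite ([verts G]\<^bsup>2\<^esup>)"
    using assms by (simp_all add: simple_graph_iff_nsets finite_imp_finite_nsets)
  then show ?thesis
    using card_mono[of "[verts G]\<^bsup>2\<^esup>" "edges G"] simple_graph_finite_edges[OF assms]
    by (simp add: complement_def card_Diff_subset)
qed

lemma no_induced_complement:
  assumes "no_induced k m G" "m \<le> k choose 2"
  shows "no_induced k ((k choose 2) - m) (complement G)"
  unfolding no_induced_def
proof (intro conjI ballI)
  have G: "simple_graph G" using assms(1) by (rule no_induced_simple_graph)
  then show "simple_graph (complement G)"
    by (auto simp: simple_graph_iff_nsets complement_def)
  fix W assume "W \<in> [verts (complement G)]\<^bsup>k\<^esup>"
  then have W: "W \<in> [verts G]\<^bsup>k\<^esup>" by (simp add: complement_def)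
  then have "simple_graph (W, induced_edges G W)" "card W = k"
    using G by (auto simp: simple_graph_def induced_edges_def nsets_def)
  moreover have "induced_edges (complement G) W = edges (complement (W, induced_edges G W))"
    using W by (auto simp: induced_edges_def complement_def nsets_def)
  ultimately have "card (induced_edges G W) + card (induced_edges (complement G) W) = k choose 2"
    using card_edges_complement[of "(W, induced_edges G W)"] by simp
  moreover have "card (induced_edges G W) \<noteq> m"
    using assms(1) W by (simp add: no_induced_def)
  ultimately show "card (induced_edges (complement G) W) \<noteq> (k choose 2) - m"
    using assms(2) by linarith
qed

lemma triangles_complement:
  "triangles (complement G) = {I \<in> [verts G]\<^bsup>3\<^esup>. indep I (edges G)}"
  by (fastforce simp: triangles_def complement_def clique_def indep_def nsets_def)

section \<open>Triangle-free graphs without induced stars\<close>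

lemma no_induced_star:
  assumes "no_induced (Suc k) k G" "v \<in> verts G" "I \<in> [verts G]\<^bsup>k\<^esup>" "indep I (edges G)"
  shows "\<not> I \<subseteq> neighbours G (verts G) v"
proof
  assume star: "I \<subseteq> neighbours G (verts G) v"
  have G: "simple_graph G" using assms(1) by (rule no_induced_simple_graph)
  have I: "I \<subseteq> verts G" "finite I" "card I = k" using assms(3) by (auto simp: nsets_def)
  have "v \<notin> I" "neighbours G I v = I"
    using star simple_graph_irrefl[OF G] by (auto simp: neighbours_def)
  then have "card (induced_edges G (insert v I)) = k"
    using I by (simp add: card_induced_edges_insert[OF G] induced_edges_indep[OF G assms(4)])
  moreover have "insert v I \<in> [verts G]\<^bsup>Suc k\<^esup>"
    using I \<open>v \<notin> I\<close> assms(2) by (simp add: nsets_def)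
  ultimately show False
    using assms(1) by (simp add: no_induced_def)
qed

lemma triangle_free_indep_neighbours:
  assumes "simple_graph G" "triangles G = {}" "v \<in> verts G"
  shows "indep (neighbours G (verts G) v) (edges G)"
  unfolding indep_def
proof (intro ballI impI notI)
  fix a b assume "a \<in> neighbours G (verts G) v" "b \<in> neighbours G (verts G) v"
    and "a \<noteq> b" and ab: "{a, b} \<in> edges G"
  then have verts: "{v, a, b} \<subseteq> verts G" and va: "{v, a} \<in> edges G" and vb: "{v, b} \<in> edges G"
    using assms(3) by (auto simp: neighbours_def)
  then have "v \<noteq> a" "v \<noteq> b"
    using simple_graph_irrefl[OF assms(1)] by metis+
  with verts \<open>a \<noteq> b\<close> have "{v, a, b} \<in> [verts G]\<^bsup>3\<^esup>"
    by (simp add: nsets_def)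
  moreover have "clique {v, a, b} (edges G)"
    using ab va vb by (simp add: clique_def insert_commute)
  ultimately show False
    using assms(2) by (simp add: triangles_def)
qed

lemma triangle_free_no_induced_star_degree_less:
  assumes "no_induced (Suc k) k G" "triangles G = {}" "v \<in> verts G"
  shows "card (neighbours G (verts G) v) < k"
proof (rule ccontr)
  assume "\<not> ?thesis"
  then obtain I where I: "I \<subseteq> neighbours G (verts G) v" "card I = k" "finite I"
    by (meson not_less obtain_subset_with_card_n)
  then have "I \<in> [verts G]\<^bsup>k\<^esup>" by (auto simp: nsets_def neighbours_def)
  moreover have "indep I (edges G)"
    using triangle_free_indep_neighbours[OF no_induced_simple_graph[OF assms(1)] assms(2,3)] I(1)
    by (auto simp: indep_def)
  ultimately show False
    using no_induced_star[OF assms(1,3)] I(1) by blast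
qed

lemma triangle_free_no_induced_star_card_edges_le:
  assumes "no_induced (Suc k) k G" "triangles G = {}"
  shows "2 * card (edges G) \<le> (k - 1) * card (verts G)"
proof -
  have "2 * card (edges G) = (\<Sum>v\<in>verts G. card (neighbours G (verts G) v))"
    using sum_card_neighbours[OF no_induced_simple_graph[OF assms(1)]] by simp
  also have "\<dots> \<le> (\<Sum>v\<in>verts G. k - 1)"
    using triangle_free_no_induced_star_degree_less[OF assms] by (intro sum_mono) fastforce
  finally show ?thesis by (simp add: mult.commute)
qed

section \<open>Triangles and independent triples\<close>

lemma no_induced_4_3_edge_nonedge:
  assumes "no_induced 4 3 G" "{x, y, a, b} \<in> [verts G]\<^bsup>4\<^esup>"
    and "{x, y} \<in> edges G" "{a, b} \<notin> edges G"
  shows "card (neighbours G {a, b} x) + card (neighbours G {a, b} y) \<noteq> 2"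
proof -
  have G: "simple_graph G" using assms(1) by (rule no_induced_simple_graph)
  have distinct: "distinct [x, y, a, b]"
    using assms(2) by (intro card_distinct) (simp add: nsets_def)
  have "neighbours G {y, a, b} x = insert y (neighbours G {a, b} x)"
    using assms(3) by (auto simp: neighbours_def)
  moreover have "indep {a, b} (edges G)"
    using assms(4) by (auto simp: indep_def insert_commute)
  moreover have "y \<notin> neighbours G {a, b} x" "finite (neighbours G {a, b} x)"
    using distinct by (auto simp: neighbours_def)
  ultimately have "card (induced_edges G {x, y, a, b}) =
      Suc (card (neighbours G {a, b} x) + card (neighbours G {a, b} y))"
    using distinct by (simp add: card_induced_edges_insert[OF G] induced_edges_indep[OF G])
  moreover have "card (induced_edges G {x, y, a, b}) \<noteq> 3"
    using assms(1,2) by (simp add: no_induced_def)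
  ultimately show ?thesis by simp
qed

lemma no_induced_4_3_neighbour_in_triangle:
  assumes "no_induced 4 3 G" "K \<in> triangles G" "a \<in> verts G - K"
  shows "neighbours G K a \<noteq> {}"
proof
  assume empty: "neighbours G K a = {}"
  have G: "simple_graph G" using assms(1) by (rule no_induced_simple_graph)
  have K: "K \<subseteq> verts G" "finite K" "card K = 3" "clique K (edges G)"
    using assms(2) by (auto simp: triangles_def nsets_def)
  then have "card (induced_edges G (insert a K)) = 3"
    using assms(3) empty
    by (simp add: card_induced_edges_insert[OF G] induced_edges_clique[OF G] choose_two)
  moreover have "insert a K \<in> [verts G]\<^bsup>4\<^esup>"
    using K assms(3) by (simp add: nsets_def)
  ultimately show False
    using assms(1) by (simp add: no_induced_def)
qed

context
  fixes G :: "'a graph" and K :: "'a set" and a b :: 'a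
  assumes no_induced: "no_induced 4 3 G"
    and triangle: "K \<in> triangles G"
    and nonadjacent: "a \<in> verts G - K" "b \<in> verts G - K" "a \<noteq> b" "{a, b} \<notin> edges G"
begin

lemma card_neighbours_nonadjacent_pair_sum_neq_2:
  assumes "x \<in> K" "y \<in> K" "x \<noteq> y"
  shows "card (neighbours G {a, b} x) + card (neighbours G {a, b} y) \<noteq> 2"
proof (rule no_induced_4_3_edge_nonedge[OF no_induced])
  show "{x, y, a, b} \<in> [verts G]\<^bsup>4\<^esup>"
  proof -
    have "distinct [x, y, a, b]" "{x, y, a, b} \<subseteq> verts G"
      using assms triangle nonadjacent(1-3) by (auto simp: triangles_def nsets_def)
    then show ?thesis using distinct_card[of "[x, y, a, b]"] by (simp add: nsets_def)
  qed
  show "{x, y} \<in> edges G" using assms triangle by (simp add: triangles_def clique_def)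
qed (rule nonadjacent(4))

lemma card_neighbours_nonadjacent_pair:
  assumes "x \<in> K"
  shows "card (neighbours G {a, b} x) =
    of_bool (x \<in> neighbours G K a) + of_bool (x \<in> neighbours G K b)"
proof -
  have "neighbours G {a, b} x =
      (if x \<in> neighbours G K a then {a} else {}) \<union> (if x \<in> neighbours G K b then {b} else {})"
    using assms by (auto simp: neighbours_def insert_commute)
  then show ?thesis using nonadjacent(3) by simp
qed

lemma triangle_covered_by_neighbours:
  "neighbours G K a \<union> neighbours G K b = K"
proof (rule ccontr)
  assume "\<not> ?thesis"
  then obtain u where u: "u \<in> K" "u \<notin> neighbours G K a" "u \<notin> neighbours G K b"
    by (auto simp: neighbours_def)
  obtain x where x: "x \<in> neighbours G K a" "x \<in> K" "x \<noteq> u"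
    using no_induced_4_3_neighbour_in_triangle[OF no_induced triangle nonadjacent(1)] u(2)
    by (auto simp: neighbours_def)
  obtain y where y: "y \<in> neighbours G K b" "y \<in> K" "y \<noteq> u"
    using no_induced_4_3_neighbour_in_triangle[OF no_induced triangle nonadjacent(2)] u(3)
    by (auto simp: neighbours_def)
  have "x \<notin> neighbours G K b"
    using card_neighbours_nonadjacent_pair_sum_neq_2[of u x] u x
    by (auto simp: card_neighbours_nonadjacent_pair)
  moreover have "y \<notin> neighbours G K a"
    using card_neighbours_nonadjacent_pair_sum_neq_2[of u y] u y
    by (auto simp: card_neighbours_nonadjacent_pair)
  moreover have "x \<noteq> y" using \<open>x \<notin> neighbours G K b\<close> y(1) by blast
  ultimately show False
    using card_neighbours_nonadjacent_pair_sum_neq_2[of x y] x y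
    by (simp add: card_neighbours_nonadjacent_pair)
qed

lemma two_common_neighbours_in_triangle:
  "2 \<le> card (neighbours G K a \<inter> neighbours G K b)"
proof -
  define S where "S = K - neighbours G K a \<inter> neighbours G K b"
  have K: "finite K" "card K = 3" using triangle by (auto simp: triangles_def nsets_def)
  have one_neighbour: "card (neighbours G {a, b} x) = 1" if "x \<in> S" for x
  proof -
    have "x \<in> K" "x \<in> neighbours G K a \<longleftrightarrow> x \<notin> neighbours G K b"
      using that triangle_covered_by_neighbours by (auto simp: S_def)
    then show ?thesis by (simp add: card_neighbours_nonadjacent_pair)
  qed
  have "x = y" if "x \<in> S" "y \<in> S" for x y
    using card_neighbours_nonadjacent_pair_sum_neq_2[of x y] one_neighbour[of x] one_neighbour[of y]
      that by (auto simp: S_def)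
  then have "card S \<le> 1"
    using K(1) by (auto simp: card_le_Suc0_iff_eq S_def)
  moreover have "card S = 3 - card (neighbours G K a \<inter> neighbours G K b)"
    unfolding S_def using K by (subst card_Diff_subset) (auto simp: neighbours_def)
  ultimately show ?thesis by simp
qed

end

lemma card_clique_Int_indep_le:
  assumes "finite K" "clique K E" "indep I E"
  shows "card (K \<inter> I) \<le> 1"
  using assms by (auto simp: card_le_Suc0_iff_eq clique_def indep_def)

lemma no_induced_4_3_triangle_Int_indep_empty:
  assumes "no_induced 4 3 G" "K \<in> triangles G" "I \<in> triangles (complement G)"
  shows "K \<inter> I = {}"
proof -
  have K: "finite K" "clique K (edges G)"
    using assms(2) by (auto simp: triangles_def nsets_def)
  have I: "I \<subseteq> verts G" "finite I" "card I = 3" "indep I (edges G)"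
    using assms(3) by (auto simp: triangles_complement nsets_def)
  have nonadjacent: "{v, w} \<notin> edges G" if "v \<in> I" "w \<in> I" for v w
    using that I(4) simple_graph_irrefl[OF no_induced_simple_graph[OF assms(1)]]
    by (cases "v = w") (auto simp: indep_def)
  have "2 \<le> card (I - K)"
    using K(1) I(2,3) card_clique_Int_indep_le[OF K I(4)]
    by (simp add: card_Diff_subset_Int Int_commute)
  then obtain P where "P \<subseteq> I - K" "card P = 2"
    by (rule obtain_subset_with_card_n)
  then obtain a b where ab: "a \<in> I - K" "b \<in> I - K" "a \<noteq> b"
    by (auto simp: card_2_iff)
  then have "neighbours G K a \<union> neighbours G K b = K"
    using triangle_covered_by_neighbours[OF assms(1,2), of a b] nonadjacent I(1) by blast
  then show ?thesis
    using ab nonadjacent by (auto simp: neighbours_def)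
qed

lemma no_induced_4_3_triangle_Int_indep_nonempty:
  assumes "no_induced 4 3 G" "K \<in> triangles G" "I \<in> triangles (complement G)"
  shows "K \<inter> I \<noteq> {}"
proof
  assume disjoint: "K \<inter> I = {}"
  have K: "K \<subseteq> verts G" "finite K" "card K = 3"
    using assms(2) by (auto simp: triangles_def nsets_def)
  have I: "I \<subseteq> verts G" "I \<in> [verts G]\<^bsup>3\<^esup>" "card I = 3" "indep I (edges G)"
    using assms(3) by (auto simp: triangles_complement nsets_def)
  obtain a b c where abc: "I = {a, b, c}" "a \<noteq> b" "a \<noteq> c" "b \<noteq> c"
    using I(3) by (auto simp: card_3_iff)
  have common: "2 \<le> card (neighbours G K a \<inter> neighbours G K v)" if "v \<in> {b, c}" for v
  proof (rule two_common_neighbours_in_triangle[OF assms(1,2)])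
    show "a \<in> verts G - K" "v \<in> verts G - K" "a \<noteq> v" "{a, v} \<notin> edges G"
      using that disjoint I(1,4) abc by (auto simp: indep_def)
  qed
  let ?ab = "neighbours G K a \<inter> neighbours G K b" and ?ac = "neighbours G K a \<inter> neighbours G K c"
  have sub: "?ab \<union> ?ac \<subseteq> K" by (auto simp: neighbours_def)
  then have "card ?ab + card ?ac \<le> 3 + card (?ab \<inter> ?ac)"
    using card_Un_Int[of ?ab ?ac] card_mono[OF K(2) sub] finite_subset[OF sub K(2)] K(3) by simp
  then have "?ab \<inter> ?ac \<noteq> {}"
    using common[of b] common[of c] by fastforce
  then obtain u where "u \<in> verts G" "I \<subseteq> neighbours G (verts G) u"
    using abc(1) K(1) I(1) by (auto simp: neighbours_def insert_commute)
  then show False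
    using no_induced_star[of 3 G u I] assms(1) I(2,4) by simp
qed

lemma no_induced_4_3_triangle_free_or_complement:
  assumes "no_induced 4 3 G"
  shows "triangles G = {} \<or> triangles (complement G) = {}"
proof (rule ccontr)
  assume "\<not> ?thesis"
  then obtain K I where KI: "K \<in> triangles G" "I \<in> triangles (complement G)"
    by blast
  show False
    using no_induced_4_3_triangle_Int_indep_empty[OF assms KI]
      no_induced_4_3_triangle_Int_indep_nonempty[OF assms KI] by contradiction
qed

lemma no_induced_4_3_few_or_many_edges:
  assumes "no_induced 4 3 G"
  shows "card (edges G) \<le> card (verts G) \<or>
    card (verts G) choose 2 \<le> card (edges G) + card (verts G)"
proof -
  have few: "card (edges H) \<le> card (verts H)" if "no_induced 4 3 H" "triangles H = {}"
    for H :: "'a graph"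
    using triangle_free_no_induced_star_card_edges_le[of 3 H] that by simp
  have "no_induced 4 3 (complement G)"
    using no_induced_complement[OF assms] by (simp add: choose_two)
  then have "card (edges G) \<le> card (verts G) \<or> card (edges (complement G)) \<le> card (verts G)"
    using no_induced_4_3_triangle_free_or_complement[OF assms] few[of G] few[of "complement G"]
      assms by (auto simp: complement_def)
  then show ?thesis
    using card_edges_complement[OF no_induced_simple_graph[OF assms]] by linarith
qed

section \<open>Edit distance\<close>

definition copies :: "'a set \<Rightarrow> 'b graph set \<Rightarrow> 'a graph set" where
  "copies V \<H> = {G. simple_graph G \<and> verts G = V \<and> (\<exists>H\<in>\<H>. isomorphic G H)}"

lemma isomorphic_refl: "isomorphic G G"
  unfolding isomorphic_def by (rule exI[of _ id]) simp

lemma isomorphic_card_edges: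
  assumes "simple_graph G" "simple_graph H" "isomorphic G H"
  shows "card (edges G) = card (edges H)"
proof -
  obtain f where f: "bij_betw f (verts G) (verts H)"
    and adj: "\<And>u v. u \<in> verts G \<Longrightarrow> v \<in> verts G \<Longrightarrow> {u, v} \<in> edges G \<longleftrightarrow> {f u, f v} \<in> edges H"
    using assms(3) unfolding isomorphic_def by blast
  have edge_iff: "e \<in> edges G \<longleftrightarrow> f ` e \<in> edges H" if e: "e \<in> [verts G]\<^bsup>2\<^esup>" for e
  proof -
    obtain u v where "e = {u, v}" "u \<in> verts G" "v \<in> verts G"
      using e by (rule nsets2_E)
    then show ?thesis using adj by simp
  qed
  have bij: "bij_betw (image f) ([verts G]\<^bsup>2\<^esup>) ([verts H]\<^bsup>2\<^esup>)"
    using f by (rule bij_betw_nsets)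
  have edges: "edges G \<subseteq> [verts G]\<^bsup>2\<^esup>" "edges H \<subseteq> [verts H]\<^bsup>2\<^esup>"
    using assms(1,2) by (simp_all add: simple_graph_iff_nsets)
  have "image f ` edges G = edges H"
  proof
    show "image f ` edges G \<subseteq> edges H"
      using edges(1) edge_iff by auto
    show "edges H \<subseteq> image f ` edges G"
    proof
      fix e assume e: "e \<in> edges H"
      then obtain e' where "e' \<in> [verts G]\<^bsup>2\<^esup>" "e = f ` e'"
        using edges(2) bij_betw_imp_surj_on[OF bij] by (metis imageE subsetD)
      then show "e \<in> image f ` edges G"
        using e edge_iff by simp
    qed
  qed
  then show ?thesis
    using bij_betw_same_card[OF bij_betw_subset[OF bij edges(1)]] by simp
qed

lemma finite_copies:
  assumes "finite V"
  shows "finite (copies V \<H>)"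
proof (rule finite_subset)
  show "copies V \<H> \<subseteq> {V} \<times> Pow ([V]\<^bsup>2\<^esup>)"
    by (auto simp: copies_def simple_graph_iff_nsets)
  show "finite ({V} \<times> Pow ([V]\<^bsup>2\<^esup>))"
    using assms by (simp add: finite_imp_finite_nsets)
qed

lemma edit_dist_eq_Min_copies:
  "edit_dist G \<H> = Min ((\<lambda>G'. card (sym_diff (edges G) (edges G'))) ` copies (verts G) \<H>)"
  unfolding edit_dist_def copies_def by (rule arg_cong[of _ _ Min]) blast

lemma edit_dist_le:
  assumes "finite (verts G)" "G' \<in> copies (verts G) \<H>"
  shows "edit_dist G \<H> \<le> card (sym_diff (edges G) (edges G'))"
  unfolding edit_dist_eq_Min_copies using assms by (simp add: finite_copies)

lemma edit_dist_attained:
  assumes "finite (verts G)" "copies (verts G) \<H> \<noteq> {}"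
  obtains G' where "G' \<in> copies (verts G) \<H>"
    "edit_dist G \<H> = card (sym_diff (edges G) (edges G'))"
proof -
  have "edit_dist G \<H> \<in> (\<lambda>G'. card (sym_diff (edges G) (edges G'))) ` copies (verts G) \<H>"
    unfolding edit_dist_eq_Min_copies using assms by (intro Min_in) (simp_all add: finite_copies)
  then show thesis using that by blast
qed

lemma card_le_card_sym_diff:
  assumes "finite A" "finite B"
  shows "card A \<le> card B + card (sym_diff A B)"
proof -
  have "card A \<le> card (B \<union> sym_diff A B)" using assms by (intro card_mono) auto
  then show ?thesis using card_Un_le le_trans by blast
qed

lemma edit_dist_ge_edge_count_gap:
  assumes "simple_graph G" "copies (verts G) \<H> \<noteq> {}"
    and gap: "\<And>G'. G' \<in> copies (verts G) \<H> \<Longrightarrow>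
      card (edges G') + d \<le> card (edges G) \<or> card (edges G) + d \<le> card (edges G')"
  shows "d \<le> edit_dist G \<H>"
proof -
  obtain G' where G': "G' \<in> copies (verts G) \<H>"
    and dist: "edit_dist G \<H> = card (sym_diff (edges G) (edges G'))"
    using edit_dist_attained assms(1,2) unfolding simple_graph_def by metis
  have "finite (edges G)" "finite (edges G')"
    using assms(1) G' by (auto simp: copies_def simple_graph_finite_edges)
  then show ?thesis
    using card_le_card_sym_diff[of "edges G" "edges G'"]
      card_le_card_sym_diff[of "edges G'" "edges G"] gap[OF G'] dist
    by (simp add: Un_commute) linarith
qed

lemma edit_dist_le_half_choose_two:
  assumes "simple_graph G" "(verts G, {}) \<in> copies (verts G) \<H>"
    "(verts G, [verts G]\<^bsup>2\<^esup>) \<in> copies (verts G) \<H>"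
  shows "2 * edit_dist G \<H> \<le> card (verts G) choose 2"
proof -
  have fin: "finite (verts G)" and sub: "edges G - [verts G]\<^bsup>2\<^esup> = {}"
    using assms(1) by (auto simp: simple_graph_iff_nsets)
  have "edit_dist G \<H> \<le> card (edges G)"
    using edit_dist_le[OF fin assms(2)] by simp
  moreover have "edit_dist G \<H> \<le> card (edges (complement G))"
    using edit_dist_le[OF fin assms(3)] sub by (simp add: complement_def)
  ultimately show ?thesis
    using card_edges_complement[OF assms(1)] by linarith
qed

lemma edit_dist_le_choose_two:
  assumes "simple_graph G" "copies (verts G) \<H> \<noteq> {}"
  shows "edit_dist G \<H> \<le> card (verts G) choose 2"
proof -
  have fin: "finite (verts G)" using assms(1) by (simp add: simple_graph_def)
  obtain G' where G': "G' \<in> copies (verts G) \<H>"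
    using assms(2) by blast
  then have "sym_diff (edges G) (edges G') \<subseteq> [verts G]\<^bsup>2\<^esup>"
    using assms(1) by (auto simp: copies_def simple_graph_iff_nsets)
  then have "card (sym_diff (edges G) (edges G')) \<le> card (verts G) choose 2"
    using card_mono[OF finite_imp_finite_nsets[OF fin]] by fastforce
  then show ?thesis
    using edit_dist_le[OF fin G'] by linarith
qed

text \<open>If no member of the family has order \<open>n\<close>, all the distances are the unspecified \<open>Min {}\<close>.\<close>
lemma finite_edit_dists:
  "finite {edit_dist G \<H> | G :: 'a graph. simple_graph G \<and> card (verts G) = n}"
proof (rule finite_subset)
  have "edit_dist G \<H> \<in> insert (Min {}) {..n choose 2}"
    if "simple_graph G" "card (verts G) = n" for G :: "'a graph"
  proof (cases "copies (verts G) \<H> = {}")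
    case True
    then show ?thesis by (simp add: edit_dist_eq_Min_copies)
  next
    case False
    then show ?thesis using edit_dist_le_choose_two[OF that(1) False] that(2) by simp
  qed
  then show "{edit_dist G \<H> | G :: 'a graph. simple_graph G \<and> card (verts G) = n}
      \<subseteq> insert (Min {}) {..n choose 2}"
    by blast
qed simp

lemma edit_dist_le_max_edit_dist:
  fixes G :: "nat graph"
  assumes "simple_graph G" "card (verts G) = n"
  shows "edit_dist G \<H> \<le> max_edit_dist n \<H>"
  unfolding max_edit_dist_def by (rule Max_ge[OF finite_edit_dists]) (use assms in blast)

lemma max_edit_dist_attained:
  obtains G :: "nat graph" where "simple_graph G" "card (verts G) = n"
    "max_edit_dist n \<H> = edit_dist G \<H>"
proof -
  have "simple_graph ({..<n}, {})" "card (verts ({..<n}, {})) = n"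
    by (simp_all add: simple_graph_def)
  then have "{edit_dist G \<H> | G :: nat graph. simple_graph G \<and> card (verts G) = n} \<noteq> {}"
    by blast
  then have "max_edit_dist n \<H> \<in>
      {edit_dist G \<H> | G :: nat graph. simple_graph G \<and> card (verts G) = n}"
    unfolding max_edit_dist_def by (rule Max_in[OF finite_edit_dists])
  then show thesis using that by blast
qed

section \<open>Distance from the graphs without induced subgraphs of order 4 and size 3\<close>

lemma no_induced_4_3_in_copies:
  fixes G :: "nat graph"
  assumes "no_induced 4 3 G"
  shows "G \<in> copies (verts G) (no_induced_4_3 (card (verts G)))"
proof -
  have "G \<in> no_induced_4_3 (card (verts G))" "simple_graph G"
    using assms by (simp_all add: mem_no_induced_4_3_iff no_induced_simple_graph)
  then show ?thesis
    using isomorphic_refl[of G] by (auto simp only: copies_def)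
qed

lemma max_edit_dist_no_induced_4_3_le:
  "2 * max_edit_dist n (no_induced_4_3 n) \<le> n choose 2"
proof -
  obtain G :: "nat graph" where G: "simple_graph G" "card (verts G) = n"
    "max_edit_dist n (no_induced_4_3 n) = edit_dist G (no_induced_4_3 n)"
    by (rule max_edit_dist_attained)
  have empty: "no_induced 4 3 (verts G, {})"
    using G(1) by (intro no_induced_empty) (simp_all add: simple_graph_def)
  then have "no_induced 4 3 (verts G, [verts G]\<^bsup>2\<^esup>)"
    using no_induced_complement[OF empty] by (simp add: complement_def choose_two)
  then show ?thesis
    using edit_dist_le_half_choose_two[OF G(1)] no_induced_4_3_in_copies empty G(2,3) by fastforce
qed

lemma max_edit_dist_no_induced_4_3_ge:
  "(n choose 2) div 2 \<le> max_edit_dist n (no_induced_4_3 n) + n"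
proof -
  obtain E where "E \<subseteq> [{..<n}]\<^bsup>2\<^esup>" and E: "card E = (n choose 2) div 2"
    using obtain_subset_with_card_n[of "(n choose 2) div 2" "[{..<n}]\<^bsup>2\<^esup>"] by auto
  then have G: "simple_graph ({..<n}, E)" by (simp add: simple_graph_iff_nsets)
  have "(n choose 2) div 2 - n \<le> edit_dist ({..<n}, E) (no_induced_4_3 n)"
  proof (rule edit_dist_ge_edge_count_gap[OF G])
    show "copies (verts ({..<n}, E)) (no_induced_4_3 n) \<noteq> {}"
      using no_induced_4_3_in_copies[OF no_induced_empty[of "{..<n}"]] by auto
    fix G' assume "G' \<in> copies (verts ({..<n}, E)) (no_induced_4_3 n)"
    then obtain H where G': "simple_graph G'" "isomorphic G' H" and "H \<in> no_induced_4_3 n"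
      unfolding copies_def by blast
    then have H: "no_induced 4 3 H" "card (verts H) = n"
      by (simp_all add: mem_no_induced_4_3_iff)
    have "card (edges G') = card (edges H)"
      using G'(1) no_induced_simple_graph[OF H(1)] G'(2) by (rule isomorphic_card_edges)
    then have "card (edges G') \<le> n \<or> n choose 2 \<le> card (edges G') + n"
      using no_induced_4_3_few_or_many_edges[OF H(1)] H(2) by simp
    then show "card (edges G') + ((n choose 2) div 2 - n) \<le> card (edges ({..<n}, E)) \<or>
        card (edges ({..<n}, E)) + ((n choose 2) div 2 - n) \<le> card (edges G')"
      using E by auto
  qed
  also have "\<dots> \<le> max_edit_dist n (no_induced_4_3 n)"
    using G by (intro edit_dist_le_max_edit_dist) simp_all
  finally show ?thesis by linarith
qed

lemma real_choose_two: "real (n choose 2) = ((real n)\<^sup>2 - real n) / 2"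
  by (induction n) (auto simp: choose_two numeral_2_eq_2 power2_eq_square field_simps)

lemma floor_eq_half_choose_two_minus:
  "\<lfloor>((real n)\<^sup>2 - 5 * real n) / 4\<rfloor> = int ((n choose 2) div 2) - int n"
proof -
  have "((real n)\<^sup>2 - 5 * real n) / 4 = real (n choose 2) / real 2 - of_int (int n)"
    by (simp add: real_choose_two field_simps)
  then show ?thesis
    by (simp only: floor_diff_of_int floor_divide_of_nat_eq)
qed

theorem theorem5p2:
  fixes n :: nat
  shows "real_of_int \<lfloor>((real n)\<^sup>2 - 5 * real n) / 4\<rfloor> \<le> real (max_edit_dist n (no_induced_4_3 n)) \<and>
    real (max_edit_dist n (no_induced_4_3 n)) \<le> ((real n)\<^sup>2 - real n) / 4"
proof
  show "real_of_int \<lfloor>((real n)\<^sup>2 - 5 * real n) / 4\<rfloor> \<le> real (max_edit_dist n (no_induced_4_3 n))"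
    using max_edit_dist_no_induced_4_3_ge[of n] by (simp add: floor_eq_half_choose_two_minus)
  have "2 * real (max_edit_dist n (no_induced_4_3 n)) \<le> real (n choose 2)"
    using max_edit_dist_no_induced_4_3_le[of n] by linarith
  then show "real (max_edit_dist n (no_induced_4_3 n)) \<le> ((real n)\<^sup>2 - real n) / 4"
    by (simp add: real_choose_two)
qed

end
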